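(* Let $k\ge 3$ and $m\ge 2$ be integers and let $\mathcal{T}$ be a $k$-uniform supertree on $n$ vertices with $m=\frac{n-1}{k-1}$ edges. Then $$\log(km)-\frac{\log m}{k}\;\le\; I_d^1(\mathcal{T})\;\le\;\log(km)-\frac{2(m-1)\log 2}{km},$$ where equality holds in the first inequality if and only if $\mathcal{T}$ is isomorphic to the hyperstar $S^k_{m+1}$, and equality holds in the second inequality if and only if the maximum vertex degree of $\mathcal{T}$ is $2$.
   Context: All logarithms are to base $2$. A $k$-uniform hypergraph $\mathcal{H}$ consists of a finite vertex set and a set of distinct edges, each edge being a $k$-element subset of the vertex set (so hypergraphs are simple). The degree $d_v$ of a vertex $v$ is the number of edges containing $v$. A walk is a sequence $v_0e_1v_1e_2\cdots e_lv_l$ with $\{v_{i-1},v_i\}\subseteq e_i$; $\mathcal{H}$ is connected if any two vertices are joined by a walk. A cycle is a walk with $l\ge 2$, $v_0=v_l$, and no other repetition of vertices or edges. A supertree is a connected hypergraph containing no cycle; equivalently, a connected $k$-uniform hypergraph with $n$ vertices and $m$ edges is a supertree iff $m(k-1)=n-1$. The hyperstar $S^k_{m+1}$ is the $k$-uniform hypergraph with $m$ edges that all contain one common vertex and are otherwise pairwise disjoint (the $k$-th power of the star with $m+1$ vertices). For a hypergraph with vertex degrees $d_1,\dots,d_n$ (all positive), the first degree-based graph entropy is $$I_d^1(\mathcal{H})=-\sum_{i=1}^n\frac{d_i}{\sum_{j=1}^n d_j}\log\frac{d_i}{\sum_{j=1}^n d_j}.$$ *)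

theory Defs
  imports Complex_Main
begin

definition uniform_hypergraph :: "nat \<Rightarrow> 'a set \<Rightarrow> 'a set set \<Rightarrow> bool" where
  "uniform_hypergraph k V E \<longleftrightarrow> finite V \<and> (\<forall>e\<in>E. e \<subseteq> V \<and> card e = k)"

definition degree :: "'a set set \<Rightarrow> 'a \<Rightarrow> nat" where
  "degree E v = card {e \<in> E. v \<in> e}"

(* The walk v_0 e_1 v_1 ... e_l v_l is given by vs = [v_0, ..., v_l] and es = [e_1, ..., e_l];
   the edge e_(i+1) is es ! i.  Walks of length l = 0 are allowed. *)
definition walk :: "'a set \<Rightarrow> 'a set set \<Rightarrow> 'a list \<Rightarrow> 'a set list \<Rightarrow> bool" where
  "walk V E vs es \<longleftrightarrow>
     length vs = Suc (length es) \<and> set vs \<subseteq> V \<and> set es \<subseteq> E \<and>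
     (\<forall>i < length es. {vs ! i, vs ! Suc i} \<subseteq> es ! i)"

definition connected_hypergraph :: "'a set \<Rightarrow> 'a set set \<Rightarrow> bool" where
  "connected_hypergraph V E \<longleftrightarrow>
     (\<forall>u\<in>V. \<forall>v\<in>V. \<exists>vs es. walk V E vs es \<and> hd vs = u \<and> last vs = v)"

definition cycle :: "'a set \<Rightarrow> 'a set set \<Rightarrow> 'a list \<Rightarrow> 'a set list \<Rightarrow> bool" where
  "cycle V E vs es \<longleftrightarrow>
     walk V E vs es \<and> length es \<ge> 2 \<and> hd vs = last vs \<and> distinct (tl vs) \<and> distinct es"

definition supertree :: "nat \<Rightarrow> 'a set \<Rightarrow> 'a set set \<Rightarrow> bool" where
  "supertree k V E \<longleftrightarrow>
     uniform_hypergraph k V E \<and> connected_hypergraph V E \<and> (\<nexists>vs es. cycle V E vs es)"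

definition isomorphic_hypergraphs ::
    "'a set \<Rightarrow> 'a set set \<Rightarrow> 'b set \<Rightarrow> 'b set set \<Rightarrow> bool" where
  "isomorphic_hypergraphs V E V' E' \<longleftrightarrow>
     (\<exists>f. bij_betw f V V' \<and> (\<lambda>e. f ` e) ` E = E')"

(* The hyperstar with m edges: None is the common vertex, and the vertices Some (i, j)
   with j < k - 1 are the remaining k - 1 vertices of the i-th edge. *)
definition hyperstar_verts :: "nat \<Rightarrow> nat \<Rightarrow> (nat \<times> nat) option set" where
  "hyperstar_verts k m = insert None (Some ` ({..<m} \<times> {..<k - 1}))"

definition hyperstar_edges :: "nat \<Rightarrow> nat \<Rightarrow> (nat \<times> nat) option set set" where
  "hyperstar_edges k m = (\<lambda>i. insert None (Some ` ({i} \<times> {..<k - 1}))) ` {..<m}"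

definition degree_entropy :: "'a set \<Rightarrow> 'a set set \<Rightarrow> real" where
  "degree_entropy V E =
     - (\<Sum>v\<in>V. real (degree E v) / (\<Sum>u\<in>V. real (degree E u)) *
          log 2 (real (degree E v) / (\<Sum>u\<in>V. real (degree E u))))"

end

theory Submission
  imports Defs
begin

text \<open>
  Since the degrees add up to km, the entropy equals log(km) minus the sum of the d log d divided
  by km. The excesses d - 1 add up to km - n = m - 1. As the quotient of d log d by d - 1 is
  strictly increasing, 2(d - 1) \<le> d log d \<le> (d - 1) m log m / (m - 1) for the integers
  1 \<le> d \<le> m, with equality on the left iff d is 1 or 2, and on the right iff d is 1 or m.
  Summing over the vertices yields both bounds. Equality in the lower one means that some vertex
  lies in all edges; then the excess is used up, so every other vertex lies in just one edge.
\<close>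

section \<open>Linear bounds for d log d in terms of d - 1\<close>

lemma x_ln_x_quotient_strict_mono:
  fixes x y :: real
  assumes "1 < x" "x < y"
  shows "x * ln x / (x - 1) < y * ln y / (y - 1)"
proof (rule DERIV_pos_imp_increasing[OF assms(2)])
  fix z assume z: "x \<le> z" "z \<le> y"
  hence z1: "z > 1" using assms by simp
  \<comment> \<open>The numerator from the quotient rule, (ln z + 1)(z - 1) - z ln z, collapses to z
    - 1 - ln z, which is positive for z > 1.\<close>
  have "((\<lambda>z. z * ln z / (z - 1)) has_real_derivative (z - 1 - ln z) / (z - 1)^2) (at z)"
    using z1 by (auto intro!: derivative_eq_intros simp: field_simps power2_eq_square)
  moreover have "ln z < z - 1"
    using ln_add_one_self_less_self[of "z - 1"] z1 by simp
  ultimately show "\<exists>d. ((\<lambda>z. z * ln z / (z - 1)) has_real_derivative d) (at z) \<and> 0 < d"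
    using z1 by (intro exI conjI) auto
qed

text \<open>The right-hand side is the chord of t log t over [1, y], as this function vanishes at t
  = 1. Clearing x - 1 from the monotone quotient and dividing by ln 2 gives the claim.\<close>

lemma x_log_x_chord_less:
  fixes x y :: real
  assumes "1 < x" "x < y"
  shows "x * log 2 x < (x - 1) * (y * log 2 y / (y - 1))"
proof -
  have "x * ln x < (x - 1) * (y * ln y / (y - 1))"
    using x_ln_x_quotient_strict_mono[OF assms] assms by (simp add: field_simps)
  hence "x * ln x / ln 2 < (x - 1) * (y * ln y / (y - 1)) / ln 2"
    by (rule divide_strict_right_mono) simp
  thus ?thesis by (simp add: log_def mult.commute)
qed

text \<open>The endpoints 1 and m lie on the chord, and every integer strictly between them falls
  strictly below it.\<close>

lemma nat_log_chord_le:
  fixes d m :: nat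
  assumes "1 \<le> d" "d \<le> m" "2 \<le> m"
  shows "real d * log 2 d \<le> (real d - 1) * (m * log 2 m / (real m - 1))"
    and "real d * log 2 d = (real d - 1) * (m * log 2 m / (real m - 1)) \<longleftrightarrow> d = 1 \<or> d = m"
proof -
  consider "d = 1" | "d = m" | "1 < d" "d < m" using assms by linarith
  hence "real d * log 2 d \<le> (real d - 1) * (m * log 2 m / (real m - 1)) \<and>
    (real d * log 2 d = (real d - 1) * (m * log 2 m / (real m - 1)) \<longleftrightarrow> d = 1 \<or> d = m)"
  proof cases
    case 3
    thus ?thesis using x_log_x_chord_less[of "real d" "real m"] by simp
  qed (use assms in auto)
  thus "real d * log 2 d \<le> (real d - 1) * (m * log 2 m / (real m - 1))"
    and "real d * log 2 d = (real d - 1) * (m * log 2 m / (real m - 1)) \<longleftrightarrow> d = 1 \<or> d = m"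
    by auto
qed

text \<open>The chord lemma is now used with 2 as the interior point of [1, d]: since
  \<open>2 * log 2 2 = 2\<close>, the quotient at 2 is the slope 2. The values d = 1 and d = 2 give
  equality.\<close>

lemma nat_log_ge:
  fixes d :: nat
  assumes "1 \<le> d"
  shows "2 * (real d - 1) \<le> real d * log 2 d"
    and "2 * (real d - 1) = real d * log 2 d \<longleftrightarrow> d \<le> 2"
proof -
  consider "d = 1" | "d = 2" | "2 < d" using assms by linarith
  hence "2 * (real d - 1) \<le> real d * log 2 d \<and>
    (2 * (real d - 1) = real d * log 2 d \<longleftrightarrow> d \<le> 2)"
  proof cases
    case 3
    thus ?thesis using x_log_x_chord_less[of 2 "real d"] by (simp add: field_simps)
  qed auto
  thus "2 * (real d - 1) \<le> real d * log 2 d"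
    and "2 * (real d - 1) = real d * log 2 d \<longleftrightarrow> d \<le> 2" by auto
qed

section \<open>Vertex degrees and their relation to the entropy\<close>

lemma sum_degree:
  assumes "uniform_hypergraph k V E"
  shows "(\<Sum>v\<in>V. degree E v) = k * card E"
proof -
  have V: "finite V" and e: "\<And>e. e \<in> E \<Longrightarrow> e \<subseteq> V" "\<And>e. e \<in> E \<Longrightarrow> card e = k"
    using assms by (auto simp: uniform_hypergraph_def)
  hence "finite E" by (auto intro: finite_subset[of E "Pow V"])
  \<comment> \<open>Double counting of the incident pairs of a vertex and an edge.\<close>
  have "(\<Sum>v\<in>V. degree E v) = (\<Sum>v\<in>V. \<Sum>e\<in>E. if v \<in> e then 1 else 0)"
    using \<open>finite E\<close> by (simp add: degree_def sum.If_cases Int_def)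
  also have "\<dots> = (\<Sum>e\<in>E. \<Sum>v\<in>V. if v \<in> e then 1 else 0)"
    by (rule sum.swap)
  also have "\<dots> = (\<Sum>e\<in>E. k)"
  proof (rule sum.cong)
    fix e assume "e \<in> E"
    hence "V \<inter> {v. v \<in> e} = e" using e by auto
    thus "(\<Sum>v\<in>V. if v \<in> e then 1 else 0) = k"
      using V e \<open>e \<in> E\<close> by (simp add: sum.If_cases)
  qed simp
  finally show ?thesis by (simp add: mult.commute)
qed

lemma degree_le_card:
  assumes "finite E"
  shows "degree E v \<le> card E"
  unfolding degree_def using assms by (intro card_mono) auto

lemma degree_eq_card_iff:
  assumes "finite E"
  shows "degree E v = card E \<longleftrightarrow> (\<forall>e\<in>E. v \<in> e)"
proof
  assume "degree E v = card E"
  hence "{e \<in> E. v \<in> e} = E"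
    unfolding degree_def using assms by (intro card_subset_eq) auto
  thus "\<forall>e\<in>E. v \<in> e" by auto
next
  assume "\<forall>e\<in>E. v \<in> e"
  hence "{e \<in> E. v \<in> e} = E" by auto
  thus "degree E v = card E" by (simp add: degree_def)
qed

text \<open>A walk from v to a different vertex has at least one edge, and its first edge contains
  v.\<close>

lemma connected_degree_pos:
  assumes "connected_hypergraph V E" "finite E" "v \<in> V" "V \<noteq> {v}"
  shows "1 \<le> degree E v"
proof -
  obtain u where u: "u \<in> V" "u \<noteq> v" using assms by auto
  then obtain vs es where w: "walk V E vs es" "hd vs = v" "last vs = u"
    using assms unfolding connected_hypergraph_def by blast
  have "es \<noteq> []"
  proof
    assume "es = []"
    hence "length vs = 1" using w by (simp add: walk_def)
    thus False using w u by (auto simp: length_Suc_conv)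
  qed
  hence "es ! 0 \<in> E" "vs ! 0 \<in> es ! 0" using w by (auto simp: walk_def)
  moreover have "vs ! 0 = v" using w by (cases vs) (auto simp: walk_def)
  ultimately have "{e \<in> E. v \<in> e} \<noteq> {}" by auto
  thus ?thesis using assms(2) by (simp add: degree_def Suc_le_eq card_gt_0_iff)
qed

text \<open>Positive degrees allow log(d/s) to be split as log d - log s; the log s parts add up to
  log s because the degrees sum to s.\<close>

lemma degree_entropy_eq:
  assumes "(\<Sum>v\<in>V. degree E v) = s" "0 < s" "\<And>v. v \<in> V \<Longrightarrow> 1 \<le> degree E v"
  shows "degree_entropy V E = log 2 s - (\<Sum>v\<in>V. degree E v * log 2 (degree E v)) / s"
proof -
  have s: "(\<Sum>v\<in>V. real (degree E v)) = s" using assms(1) by (metis of_nat_sum)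
  have "degree_entropy V E =
      - (\<Sum>v\<in>V. degree E v * log 2 (degree E v) / s - degree E v * (log 2 s / s))"
    unfolding degree_entropy_def s
    using assms by (intro arg_cong[where f = uminus] sum.cong)
      (auto simp: log_divide field_simps)
  also have "\<dots> = log 2 s - (\<Sum>v\<in>V. degree E v * log 2 (degree E v)) / s"
    using assms(2) by (simp add: sum_subtractf s flip: sum_distrib_right sum_divide_distrib)
  finally show ?thesis .
qed

section \<open>Characterization of the hyperstar by a common vertex\<close>

lemma isomorphic_hyperstarI:
  assumes hyp: "uniform_hypergraph k V E" and m: "card E = m" "finite E"
    and c: "c \<in> V" "\<And>e. e \<in> E \<Longrightarrow> c \<in> e"
    and uniq: "\<And>v. v \<in> V - {c} \<Longrightarrow> \<exists>!e. e \<in> E \<and> v \<in> e" and "E \<noteq> {}"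
  shows "isomorphic_hypergraphs V E (hyperstar_verts k m) (hyperstar_edges k m)"
proof -
  have e: "finite e" "e \<subseteq> V" "card e = k" if "e \<in> E" for e
    using that hyp by (auto simp: uniform_hypergraph_def intro: finite_subset)
  \<comment> \<open>Coordinates for the isomorphism: \<open>h\<close> numbers the edges, and
    \<open>g e\<close> numbers the k - 1 vertices of e other than c.\<close>
  obtain h where h: "bij_betw h E {..<m}"
    using m ex_bij_betw_finite_nat[OF m(2)] by (auto simp: atLeast0LessThan)
  have "\<exists>g. bij_betw g (e - {c}) {..<k - 1}" if "e \<in> E" for e
    using that e c(2) ex_bij_betw_finite_nat[of "e - {c}"] by (auto simp: atLeast0LessThan)
  then obtain g where g: "\<And>e. e \<in> E \<Longrightarrow> bij_betw (g e) (e - {c}) {..<k - 1}"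
    by metis
  \<comment> \<open>By \<open>uniq\<close> this description is proper away from c; at c its value
    never matters, as \<open>f\<close> sends c to \<open>None\<close> directly.\<close>
  define ed where "ed v = (THE e. e \<in> E \<and> v \<in> e)" for v
  have ed: "ed v \<in> E" "v \<in> ed v" if "v \<in> V - {c}" for v
    using theI'[OF uniq[OF that]] by (auto simp: ed_def)
  have ed_eq: "ed v = e" if "e \<in> E" "v \<in> e" "v \<noteq> c" for v e
    using that e(2)[OF that(1)] ed[of v] uniq[of v] by blast
  define f where "f v = (if v = c then None else Some (h (ed v), g (ed v) v))" for v
  have f_edge: "f ` x = insert None (Some ` ({h x} \<times> {..<k - 1}))" if "x \<in> E" for x
  proof -
    have "f ` x = insert None (f ` (x - {c}))"
      using c(2)[OF that] by (auto simp: f_def)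
    also have "f ` (x - {c}) = (\<lambda>v. Some (h x, g x v)) ` (x - {c})"
      using that by (intro image_cong) (auto simp: f_def ed_eq)
    also have "\<dots> = Some ` ({h x} \<times> (g x ` (x - {c})))" by auto
    also have "g x ` (x - {c}) = {..<k - 1}"
      using g[OF that] by (simp add: bij_betw_def)
    finally show ?thesis .
  qed
  have hE: "h ` E = {..<m}" using h by (simp add: bij_betw_def)
  have edges: "(\<lambda>e. f ` e) ` E = hyperstar_edges k m"
    unfolding hyperstar_edges_def hE[symmetric] image_image using f_edge by (rule image_cong[OF refl])
  \<comment> \<open>With no isolated vertices, the image of V can be read off from the images of the
    edges.\<close>
  have "V = \<Union>E"
    using e(2) c \<open>E \<noteq> {}\<close> uniq by blast
  hence "f ` V = \<Union>(hyperstar_edges k m)" by (simp add: image_Union flip: edges)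
  also have "\<dots> = hyperstar_verts k m"
    using hE \<open>E \<noteq> {}\<close> by (auto simp: hyperstar_edges_def hyperstar_verts_def)
  finally have "f ` V = hyperstar_verts k m" .
  moreover have "inj_on f V"
  proof (rule inj_onI)
    fix u v assume uv: "u \<in> V" "v \<in> V" "f u = f v"
    show "u = v"
    proof (cases "u = c \<or> v = c")
      case False
      hence *: "u \<in> V - {c}" "v \<in> V - {c}" using uv by auto
      \<comment> \<open>The first coordinate forces u and v into the same edge; within it,
        injectivity of \<open>g\<close> separates vertices.\<close>
      have "h (ed u) = h (ed v)" "g (ed u) u = g (ed v) v"
        using uv False by (auto simp: f_def)
      moreover from this have "ed u = ed v"
        using h ed * by (auto simp: bij_betw_def dest: inj_onD)
      ultimately show ?thesis
        using g[OF ed(1)[OF *(1)]] ed[OF *(1)] ed[OF *(2)] *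
        by (auto simp: bij_betw_def dest: inj_onD)
    qed (use uv in \<open>auto simp: f_def split: if_splits\<close>)
  qed
  ultimately show ?thesis
    unfolding isomorphic_hypergraphs_def using edges by (auto simp: bij_betw_def)
qed

text \<open>The center is the preimage of \<open>None\<close>, which lies in every edge of the
  hyperstar. Edges are subsets of V, so injectivity on V identifies the preimage inside each edge
  with c.\<close>

lemma isomorphic_hyperstar_center:
  assumes "isomorphic_hypergraphs V E (hyperstar_verts k m) (hyperstar_edges k m)"
    and "\<And>e. e \<in> E \<Longrightarrow> e \<subseteq> V"
  shows "\<exists>c\<in>V. \<forall>e\<in>E. c \<in> e"
proof -
  obtain f where f: "bij_betw f V (hyperstar_verts k m)" "(\<lambda>e. f ` e) ` E = hyperstar_edges k m"
    using assms(1) by (auto simp: isomorphic_hypergraphs_def)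
  have "None \<in> f ` V" using f(1) by (simp add: bij_betw_def hyperstar_verts_def)
  then obtain c where c: "c \<in> V" "f c = None" by auto
  have "c \<in> e" if "e \<in> E" for e
  proof -
    have "f ` e \<in> hyperstar_edges k m" using f(2) that by blast
    hence "None \<in> f ` e" by (auto simp: hyperstar_edges_def)
    then obtain x where "x \<in> e" "f x = f c" using c by auto
    moreover from this have "x = c"
      using f(1) c assms(2)[OF that] by (intro inj_onD[of f V]) (auto simp: bij_betw_def)
    ultimately show ?thesis by simp
  qed
  thus ?thesis using c by blast
qed

text \<open>Reduces equality in a summed bound to equality at each vertex: nonnegative differences
  with sum zero all vanish.\<close>

lemma sum_mono_eq_iff:
  fixes f g :: "'a \<Rightarrow> real"
  assumes "finite A" "\<And>x. x \<in> A \<Longrightarrow> f x \<le> g x"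
  shows "sum f A = sum g A \<longleftrightarrow> (\<forall>x\<in>A. f x = g x)"
proof -
  have "sum f A = sum g A \<longleftrightarrow> (\<Sum>x\<in>A. g x - f x) = 0" by (auto simp: sum_subtractf)
  also have "\<dots> \<longleftrightarrow> (\<forall>x\<in>A. g x - f x = 0)"
    using assms by (intro sum_nonneg_eq_0_iff) auto
  finally show ?thesis by auto
qed

section \<open>The entropy bounds and their equality cases\<close>

theorem theorem1:
  fixes V :: "'a set" and E :: "'a set set" and k m n :: nat
  assumes "k \<ge> 3" and "m \<ge> 2"
    and "supertree k V E"
    and "card V = n" and "card E = m"
    and "real m = (real n - 1) / (real k - 1)"
  shows "log 2 (real k * real m) - log 2 (real m) / real k \<le> degree_entropy V E \<and>
         degree_entropy V E
           \<le> log 2 (real k * real m) - 2 * (real m - 1) * log 2 2 / (real k * real m) \<and>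
         (log 2 (real k * real m) - log 2 (real m) / real k = degree_entropy V E \<longleftrightarrow>
           isomorphic_hypergraphs V E (hyperstar_verts k m) (hyperstar_edges k m)) \<and>
         (degree_entropy V E
           = log 2 (real k * real m) - 2 * (real m - 1) * log 2 2 / (real k * real m) \<longleftrightarrow>
           Max (degree E ` V) = 2)"
proof -
  have hyp: "uniform_hypergraph k V E" and conn: "connected_hypergraph V E"
    using assms(3) by (auto simp: supertree_def)
  have fin: "finite V" "finite E" and sub: "\<And>e. e \<in> E \<Longrightarrow> e \<subseteq> V"
    using hyp assms(2,5) by (auto simp: uniform_hypergraph_def intro: card_ge_0_finite)
  have n: "real n - 1 = real m * (real k - 1)" using assms(1,6) by simp
  \<comment> \<open>This rules out a single vertex, so that connectivity makes every degree
    positive.\<close>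
  have "real m * (real k - 1) \<ge> 2 * 2" using assms(1,2) by (intro mult_mono) auto
  hence n2: "n \<ge> 2" using n by linarith
  have "V \<noteq> {v}" for v using n2 assms(4) by auto
  hence deg: "1 \<le> degree E v" "degree E v \<le> m" if "v \<in> V" for v
    using connected_degree_pos[OF conn fin(2) that] degree_le_card[OF fin(2)] assms(5) by auto
  define excess where "excess v = real (degree E v) - 1" for v
  define F where "F = (\<Sum>v\<in>V. degree E v * log 2 (degree E v))"
  have degsum: "(\<Sum>v\<in>V. degree E v) = k * m"
    using sum_degree[OF hyp] assms(5) by simp
  hence "(\<Sum>v\<in>V. real (degree E v)) = real k * real m" by (metis of_nat_sum of_nat_mult)
  hence excess_sum: "(\<Sum>v\<in>V. excess v) = real m - 1"
    using n assms(4) by (simp add: excess_def sum_subtractf algebra_simps)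
  have km: "real k * real m > 0" using assms(1,2) by simp
  have ent: "degree_entropy V E = log 2 (real k * real m) - F / (real k * real m)"
    using degree_entropy_eq[OF degsum _ deg(1)] assms(1,2) by (simp add: F_def)

  \<comment> \<open>\<open>lower\<close> and \<open>upper\<close> refer to bounds on
    \<open>F\<close>. Since \<open>F\<close> enters the entropy with a minus sign, they produce the
    upper and the lower entropy bound, respectively.\<close>
  have lower: "(\<Sum>v\<in>V. 2 * excess v) = 2 * (real m - 1)"
    by (simp add: excess_sum flip: sum_distrib_left)
  have upper: "(\<Sum>v\<in>V. excess v * (m * log 2 m / (real m - 1))) = m * log 2 m"
    unfolding sum_distrib_right[symmetric] excess_sum using assms(2) by simp
  have F_ge: "2 * (real m - 1) \<le> F"
    unfolding F_def lower[symmetric] excess_def by (intro sum_mono nat_log_ge(1) deg)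
  have F_le: "F \<le> m * log 2 m"
    unfolding F_def
    by (subst upper[symmetric], unfold excess_def) (intro sum_mono nat_log_chord_le(1) deg assms)
  have F_eq_lower: "2 * (real m - 1) = F \<longleftrightarrow> (\<forall>v\<in>V. degree E v \<le> 2)"
    unfolding F_def lower[symmetric] excess_def
    by (subst sum_mono_eq_iff) (use fin deg nat_log_ge in blast)+
  have F_eq_upper: "F = m * log 2 m \<longleftrightarrow> (\<forall>v\<in>V. degree E v = 1 \<or> degree E v = m)"
    unfolding F_def
    by (subst upper[symmetric], unfold excess_def, subst sum_mono_eq_iff)
      (use fin deg assms(2) nat_log_chord_le in blast)+

  \<comment> \<open>The total excess m - 1 is positive. This makes the maximum exactly 2 once all
    degrees are at most 2, and supplies a center when all degrees are 1 or m.\<close>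
  have not_all_1: "\<exists>v\<in>V. degree E v \<noteq> 1"
  proof (rule ccontr)
    assume "\<not> ?thesis"
    hence "(\<Sum>v\<in>V. excess v) = 0" by (intro sum.neutral) (simp add: excess_def)
    thus False using excess_sum assms(2) by simp
  qed
  have max2: "(\<forall>v\<in>V. degree E v \<le> 2) \<longleftrightarrow> Max (degree E ` V) = 2"
  proof
    assume le: "\<forall>v\<in>V. degree E v \<le> 2"
    obtain v where v: "v \<in> V" "degree E v \<noteq> 1" using not_all_1 by auto
    hence "degree E v = 2" using le deg(1)[of v] by force
    thus "Max (degree E ` V) = 2" using fin v le by (intro Max_eqI) force+
  next
    assume "Max (degree E ` V) = 2"
    thus "\<forall>v\<in>V. degree E v \<le> 2" using fin Max_ge[of "degree E ` V"] by auto
  qed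

  have center: "\<forall>v\<in>V - {c}. degree E v = 1" if "c \<in> V" "degree E c = m" for c
  proof -
    have "(\<Sum>v\<in>V - {c}. excess v) = 0"
      using sum.remove[OF fin(1) that(1), of excess] excess_sum that(2)
      unfolding excess_def[of c] by linarith
    hence "\<forall>v\<in>V - {c}. excess v = 0"
      using fin deg by (subst (asm) sum_nonneg_eq_0_iff) (auto simp: excess_def)
    thus ?thesis by (auto simp: excess_def)
  qed
  have star: "(\<forall>v\<in>V. degree E v = 1 \<or> degree E v = m) \<longleftrightarrow>
      isomorphic_hypergraphs V E (hyperstar_verts k m) (hyperstar_edges k m)"
  proof
    assume "\<forall>v\<in>V. degree E v = 1 \<or> degree E v = m"
    then obtain c where c: "c \<in> V" "degree E c = m" using not_all_1 by blast
    show "isomorphic_hypergraphs V E (hyperstar_verts k m) (hyperstar_edges k m)"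
    proof (rule isomorphic_hyperstarI[OF hyp assms(5) fin(2) c(1)])
      show "c \<in> e" if "e \<in> E" for e
        using that c(2) degree_eq_card_iff[OF fin(2), of c] assms(5) by simp
      show "\<exists>!e. e \<in> E \<and> v \<in> e" if "v \<in> V - {c}" for v
      proof -
        have "card {e \<in> E. v \<in> e} = 1" using bspec[OF center[OF c] that] by (simp only: degree_def)
        then obtain e where "{e \<in> E. v \<in> e} = {e}" by (rule card_1_singletonE)
        hence "x \<in> E \<and> v \<in> x \<longleftrightarrow> x = e" for x by (simp add: set_eq_iff)
        thus ?thesis by simp
      qed
      show "E \<noteq> {}" using assms(2,5) by auto
    qed
  next
    assume "isomorphic_hypergraphs V E (hyperstar_verts k m) (hyperstar_edges k m)"
    from isomorphic_hyperstar_center[OF this sub] obtain c where "c \<in> V" "\<forall>e\<in>E. c \<in> e"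
      by blast
    moreover from this have "degree E c = m"
      using degree_eq_card_iff[OF fin(2)] assms(5) by simp
    ultimately show "\<forall>v\<in>V. degree E v = 1 \<or> degree E v = m" using center by blast
  qed

  \<comment> \<open>Over the common denominator km, the entropy bounds become the bounds on
    \<open>F\<close> divided by km.\<close>
  have log_m: "log 2 (real m) / real k = m * log 2 m / (real k * real m)"
    using assms(2) by simp
  have "log 2 (real k * real m) - log 2 (real m) / real k \<le> degree_entropy V E"
    unfolding ent log_m using divide_right_mono[OF F_le less_imp_le[OF km]] by linarith
  moreover have "degree_entropy V E
      \<le> log 2 (real k * real m) - 2 * (real m - 1) * log 2 2 / (real k * real m)"
    unfolding ent using divide_right_mono[OF F_ge less_imp_le[OF km]] by simp
  moreover have "log 2 (real k * real m) - log 2 (real m) / real k = degree_entropy V E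
      \<longleftrightarrow> F = m * log 2 m"
    unfolding ent using assms(1,2) by (auto simp: field_simps)
  moreover have "degree_entropy V E
      = log 2 (real k * real m) - 2 * (real m - 1) * log 2 2 / (real k * real m)
      \<longleftrightarrow> 2 * (real m - 1) = F"
    unfolding ent using assms(1,2) by auto
  ultimately show ?thesis
    using F_eq_lower F_eq_upper max2 star by simp
qed

end
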